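(* Let $p\geq 5$ be a prime and let $N\geq 1$ be an integer. Then $$\mathrm{N}(\mathrm{P}(\mathrm{C}_{p^{N}}))-1\equiv \frac{1}{p}\left\{\binom{2p-1}{p-1}-1\right\} \pmod{p^{4}},$$ where the right-hand side is an integer by Wolstenholme's theorem.
   Context: For a finite group $G$, take independent commuting variables $x_g$ ($g\in G$) and let $M(G):=(x_{gh^{-1}})_{g,h\in G}$ be the group matrix. The group permanent is $\mathrm{P}(G):=\mathrm{perm}(M(G))=\sum_{\sigma}\prod_{g\in G}x_{g\sigma(g)^{-1}}\in\mathbb{Z}[x_g : g\in G]$, where $\sigma$ runs over all permutations of the set $G$. For a polynomial $f$, $\mathrm{N}(f)$ denotes the number of distinct monomials with nonzero coefficient in $f$. $\mathrm{C}_n$ denotes the cyclic group of order $n$. *)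

theory Defs
  imports "HOL-Algebra.Elementary_Groups" "HOL-Library.Poly_Mapping" "HOL-Combinatorics.Permutations"
    "HOL-Number_Theory.Cong"
begin

text \<open>
  Polynomials over the integers in commuting variables indexed by the type \<open>'a\<close> are finitely
  supported maps from exponent vectors (\<open>'a \<Rightarrow>\<^sub>0 nat\<close>, the monomials) to coefficients; the ring
  structure is the one of \<^theory>\<open>HOL-Library.Poly_Mapping\<close>.
\<close>

type_synonym 'a int_mpoly = "('a \<Rightarrow>\<^sub>0 nat) \<Rightarrow>\<^sub>0 int"

definition mvar :: "'a \<Rightarrow> 'a int_mpoly" where
  "mvar g = Poly_Mapping.single (Poly_Mapping.single g 1) 1"

definition num_monomials :: "'a int_mpoly \<Rightarrow> nat" where
  "num_monomials f = card (Poly_Mapping.keys f)"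

definition permanent_on :: "'i set \<Rightarrow> ('i \<Rightarrow> 'i \<Rightarrow> 'r::comm_semiring_1) \<Rightarrow> 'r" where
  "permanent_on I A = (\<Sum>\<sigma> | \<sigma> permutes I. \<Prod>i\<in>I. A i (\<sigma> i))"

definition group_matrix :: "('a, 'b) monoid_scheme \<Rightarrow> 'a \<Rightarrow> 'a \<Rightarrow> 'a int_mpoly" where
  "group_matrix G g h = mvar (g \<otimes>\<^bsub>G\<^esub> inv\<^bsub>G\<^esub> h)"

definition group_permanent :: "('a, 'b) monoid_scheme \<Rightarrow> 'a int_mpoly" where
  "group_permanent G = permanent_on (carrier G) (group_matrix G)"

end

theory Submission
  imports Defs "HOL-Combinatorics.Cycles" "HOL-Computational_Algebra.Polynomial_FPS"
    "HOL-Number_Theory.Totient" Complex_Main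
begin

text \<open>
  A term of the permanent is the monomial whose exponents record the multiset of differences
  \<open>x - \<sigma> x\<close>. Such a multiset has size \<open>n\<close> and sum zero in the cyclic group of order \<open>n\<close>, and by a theorem
  of Marshall Hall every multiset of size \<open>n\<close> and sum zero arises in this way
  (\<open>difference_mset_iff_zero_sum\<close>). The proof of Hall's theorem given here reads differences as edge
  labels of the cycles of a permutation, and modifies two of them at a time by a 2-opt move
  (\<open>edge_exchange\<close>). Since coefficients of the permanent cannot cancel, the number of monomials is the
  number \<open>A n\<close> of zero-sum multisets.

  Characters count these multisets: \<open>n * A n\<close> is the sum of \<open>c (gcd j n)\<close> over \<open>j < n\<close>, where
  \<open>c d = (2 * d - 1) choose (d - 1)\<close> (\<open>zero_sum_multisets_count\<close>). For prime powers, the sum for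
  \<open>p ^ N\<close> and \<open>p\<close> times the sum for \<open>p ^ (N - 1)\<close> differ in a single term, which gives
  \<open>p ^ N * (A (p ^ N) - A (p ^ (N - 1))) = c (p ^ N) - c (p ^ (N - 1))\<close>.
  For \<open>N = 1\<close> this is the asserted value \<open>A p - 1 = (c p - 1) / p\<close>, as \<open>A 1 = c 1 = 1\<close>. For \<open>N \<ge> 2\<close>, a
  congruence going back to Jacobsthal says that \<open>p ^ (3 * N)\<close> divides the right-hand side
  (\<open>Jacobsthal_central_binomial\<close>). So \<open>A (p ^ N)\<close> and \<open>A (p ^ (N - 1))\<close> agree modulo \<open>p ^ (2 * N)\<close>, hence
  modulo \<open>p ^ 4\<close>, and all \<open>N \<ge> 1\<close> reduce to \<open>N = 1\<close>.
\<close>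

section \<open>Exchanging edges in the cycles of a permutation\<close>

text \<open>
  The graph of a permutation \<open>\<rho>\<close> of \<open>I\<close> is a disjoint union of cycles, with one edge from each \<open>x\<close> to
  \<open>\<rho> x\<close>. For symmetric \<open>e\<close> the labels below do not depend on the orientation of these cycles.
\<close>

definition edge_labels :: "('a \<Rightarrow> 'a \<Rightarrow> 'b) \<Rightarrow> 'a set \<Rightarrow> ('a \<Rightarrow> 'a) \<Rightarrow> 'b multiset" where
  "edge_labels e I \<rho> = image_mset (\<lambda>x. e x (\<rho> x)) (mset_set I)"

lemma edge_labels_swap:
  assumes fin: "finite I" and x: "x \<in> I" and y: "y \<in> I" and neq: "x \<noteq> y"
  shows "edge_labels e I (\<rho> \<circ> transpose x y) + {#e x (\<rho> x), e y (\<rho> y)#} =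
    edge_labels e I \<rho> + {#e x (\<rho> y), e y (\<rho> x)#}"
proof -
  define J where "J = I - {x, y}"
  have I: "I = insert x (insert y J)" and J: "finite J" "x \<notin> J" "y \<notin> J"
    using assms by (auto simp: J_def)
  have "image_mset (\<lambda>z. e z ((\<rho> \<circ> transpose x y) z)) (mset_set J) =
      image_mset (\<lambda>z. e z (\<rho> z)) (mset_set J)"
    using J by (intro image_mset_cong) (auto simp: transpose_def)
  then show ?thesis
    using J neq by (simp add: edge_labels_def I)
qed

text \<open>
  An invariant set is a union of cycles. Traversing those cycles backwards changes no edge of the
  undirected graph, hence no label.
\<close>

lemma permutation_reverse_invariant_set:
  assumes fin: "finite I" and perm: "\<rho> permutes I" and SI: "S \<subseteq> I" and inv: "\<rho> ` S = S"
    and sym: "\<And>x y. e x y = e y x"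
  shows "\<exists>\<tau>. \<tau> permutes I \<and> edge_labels e I \<tau> = edge_labels e I \<rho> \<and>
    (\<forall>x\<in>S. \<tau> (\<rho> x) = x) \<and> (\<forall>x. x \<notin> S \<longrightarrow> \<tau> x = \<rho> x)"
proof -
  define \<tau> where "\<tau> = (\<lambda>x. if x \<in> S then inv_into UNIV \<rho> x else \<rho> x)"
  have inj: "inj \<rho>"
    using perm by (rule permutes_inj)
  have rev: "\<tau> (\<rho> x) = x" if "x \<in> S" for x
    using that inv inj by (auto simp: \<tau>_def)
  have out: "\<tau> x = \<rho> x" if "x \<notin> S" for x
    using that by (simp add: \<tau>_def)
  have tS: "\<tau> ` S = S"
  proof -
    have "\<tau> ` S = (\<tau> \<circ> \<rho>) ` S"
      using inv by (metis image_comp)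
    also have "\<dots> = S"
      using rev by (simp add: image_def)
    finally show ?thesis .
  qed
  have finS: "finite S"
    using fin SI by (rule rev_finite_subset)
  have tI: "\<tau> ` I = I"
  proof -
    have "\<rho> ` (I - S) = I - S"
      using inj inv permutes_image[OF perm] by (simp add: image_set_diff)
    then have "\<tau> ` (I - S) = I - S"
      using out by (simp add: image_def)
    with tS SI show ?thesis
      by (metis Un_Diff_cancel image_Un sup.absorb2)
  qed
  have "bij_betw \<tau> I I"
    using tI fin by (simp add: bij_betw_def eq_card_imp_inj_on)
  moreover have "\<tau> x = x" if "x \<notin> I" for x
    using that SI perm by (auto simp: \<tau>_def permutes_not_in)
  ultimately have "\<tau> permutes I"
    by (rule bij_imp_permutes)
  moreover have "edge_labels e I \<tau> = edge_labels e I \<rho>"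
  proof -
    have split: "mset_set I = mset_set S + mset_set (I - S)"
      using fin SI finS by (metis Diff_disjoint Un_Diff_cancel finite_Diff mset_set_Union sup.absorb2)
    have "mset_set S = image_mset \<rho> (mset_set S)"
      using inj inv by (simp add: image_mset_mset_set inj_on_subset)
    then have "image_mset (\<lambda>x. e x (\<tau> x)) (mset_set S) =
        image_mset (\<lambda>x. e x (\<tau> x)) (image_mset \<rho> (mset_set S))"
      by simp
    also have "\<dots> = image_mset (\<lambda>x. e x (\<rho> x)) (mset_set S)"
      unfolding multiset.map_comp using finS by (intro image_mset_cong) (auto simp: rev sym)
    finally have "image_mset (\<lambda>x. e x (\<tau> x)) (mset_set S) = \<dots>" .
    moreover have "image_mset (\<lambda>x. e x (\<tau> x)) (mset_set (I - S)) =
        image_mset (\<lambda>x. e x (\<rho> x)) (mset_set (I - S))"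
      using fin by (intro image_mset_cong) (auto simp: out)
    ultimately show ?thesis
      by (simp add: edge_labels_def split)
  qed
  ultimately show ?thesis
    using rev out by blast
qed

text \<open>
  When \<open>u\<close> and \<open>w\<close> lie on different cycles, the cycle through \<open>w\<close> is reversed, so that \<open>\<rho> w\<close> now points
  to \<open>w\<close>; then exchanging the images of \<open>u\<close> and \<open>\<rho> w\<close> joins \<open>u\<close> to \<open>w\<close> and \<open>\<rho> w\<close> to \<open>\<rho> u\<close>.
\<close>

lemma edge_exchange_of_invariant_set:
  assumes fin: "finite I" and perm: "\<rho> permutes I" and SI: "S \<subseteq> I" and inv: "\<rho> ` S = S"
    and sym: "\<And>x y. e x y = e y x"
    and u: "u \<in> I" "u \<notin> S" and w: "w \<in> S"
  shows "\<exists>\<tau>. \<tau> permutes I \<and> edge_labels e I \<tau> + {#e u (\<rho> u), e w (\<rho> w)#} =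
    edge_labels e I \<rho> + {#e u w, e (\<rho> u) (\<rho> w)#}"
proof -
  have "\<exists>\<sigma>. \<sigma> permutes I \<and> edge_labels e I \<sigma> = edge_labels e I \<rho> \<and>
      (\<forall>x\<in>S. \<sigma> (\<rho> x) = x) \<and> (\<forall>x. x \<notin> S \<longrightarrow> \<sigma> x = \<rho> x)"
    by (rule permutation_reverse_invariant_set[OF fin perm SI inv sym])
  with u w obtain \<sigma> where \<sigma>: "\<sigma> permutes I" "edge_labels e I \<sigma> = edge_labels e I \<rho>"
      "\<sigma> (\<rho> w) = w" "\<sigma> u = \<rho> u"
    by blast
  have rw: "\<rho> w \<in> I" "\<rho> w \<noteq> u"
    using inv w u SI by auto
  have "\<sigma> \<circ> transpose u (\<rho> w) permutes I"
    using \<sigma>(1) rw u by (intro permutes_compose permutes_swap_id) auto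
  moreover have "edge_labels e I (\<sigma> \<circ> transpose u (\<rho> w)) + {#e u (\<rho> u), e w (\<rho> w)#} =
      edge_labels e I \<rho> + {#e u w, e (\<rho> u) (\<rho> w)#}"
    using edge_labels_swap[OF fin u(1) rw(1), of e \<sigma>] rw(2) \<sigma>(2-4)
    by (simp add: sym[of w "\<rho> w"] sym[of "\<rho> u" "\<rho> w"])
  ultimately show ?thesis
    by blast
qed

text \<open>
  This is the 2-opt move on a system of cycles: cut the edges leaving \<open>u\<close> and \<open>w\<close>, and reconnect \<open>u\<close> with
  \<open>w\<close> and \<open>\<rho> u\<close> with \<open>\<rho> w\<close>. If \<open>u\<close> and \<open>w\<close> share a cycle, exchanging their images first splits that cycle
  into one through \<open>u\<close> and one through \<open>w\<close>, and the move for different cycles applies; the two auxiliary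
  labels \<open>e u (\<rho> w)\<close> and \<open>e w (\<rho> u)\<close> cancel.
\<close>

lemma edge_exchange:
  assumes fin: "finite I" and perm: "\<rho> permutes I" and sym: "\<And>x y. e x y = e y x"
    and u: "u \<in> I" and w: "w \<in> I" and neq: "u \<noteq> w"
  shows "\<exists>\<tau>. \<tau> permutes I \<and> edge_labels e I \<tau> + {#e u (\<rho> u), e w (\<rho> w)#} =
    edge_labels e I \<rho> + {#e u w, e (\<rho> u) (\<rho> w)#}"
proof -
  \<comment> \<open>Follow the cycle of \<open>w\<close> until it first returns to \<open>w\<close> or meets \<open>u\<close>; this decides which case
    holds, and the points visited form the required invariant set in both.\<close>
  define k where "k = (LEAST k. 0 < k \<and> (\<rho> ^^ k) w \<in> {u, w})"
  obtain m where "0 < m" "(\<rho> ^^ m) w = w"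
    using permutation_is_nilpotent[of \<rho>] fin perm permutation_permutes by (metis id_apply)
  then have k: "0 < k" "(\<rho> ^^ k) w \<in> {u, w}"
    and k_least: "\<And>i. 0 < i \<Longrightarrow> i < k \<Longrightarrow> (\<rho> ^^ i) w \<notin> {u, w}"
    using LeastI[of "\<lambda>k. 0 < k \<and> (\<rho> ^^ k) w \<in> {u, w}" m]
      not_less_Least[of _ "\<lambda>k. 0 < k \<and> (\<rho> ^^ k) w \<in> {u, w}"]
    unfolding k_def by auto
  define S where "S = (\<lambda>i. (\<rho> ^^ i) w) ` {1..k}"
  have SI: "S \<subseteq> I"
    using w perm by (auto simp: S_def permutes_in_funpow_image)
  have finS: "finite S"
    by (simp add: S_def)
  have inj: "inj \<rho>"
    using perm by (rule permutes_inj)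
  have step: "\<rho> x \<in> S \<and> x \<notin> {u, w}" if x: "x \<in> S" "x \<noteq> (\<rho> ^^ k) w" for x
  proof -
    obtain i where i: "x = (\<rho> ^^ i) w" "1 \<le> i" "i < k"
      using x by (force simp: S_def)
    then have "\<rho> x = (\<rho> ^^ Suc i) w" "Suc i \<in> {1..k}"
      by auto
    then have "\<rho> x \<in> S"
      unfolding S_def by (rule image_eqI)
    then show ?thesis
      using i k_least[of i] by auto
  qed
  have rw: "\<rho> w \<in> S"
    using k(1) by (force simp: S_def image_iff intro: bexI[of _ 1])
  have mem: "(\<rho> ^^ k) w \<in> S"
    using k(1) by (auto simp: S_def)
  show ?thesis
  proof (cases "(\<rho> ^^ k) w = w")
    case True
    then have "\<rho> ` S \<subseteq> S"
      using step rw by auto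
    then have "\<rho> ` S = S"
      using endo_inj_surj[OF finS] inj inj_on_subset by blast
    moreover have "u \<notin> S" "w \<in> S"
      using mem step[of u] True neq by auto
    ultimately show ?thesis
      by (rule edge_exchange_of_invariant_set[OF fin perm SI _ sym u])
  next
    case False
    then have k_u: "(\<rho> ^^ k) w = u"
      using k(2) by simp
    define \<rho>' where "\<rho>' = \<rho> \<circ> transpose u w"
    have perm': "\<rho>' permutes I"
      unfolding \<rho>'_def using u w perm by (intro permutes_compose permutes_swap_id) auto
    have "\<rho>' x \<in> S" if "x \<in> S" for x
      using step[OF that] rw k_u by (cases "x = u") (auto simp: \<rho>'_def transpose_def)
    then have "\<rho>' ` S = S"
      using endo_inj_surj[OF finS] permutes_inj[OF perm'] inj_on_subset by blast
    moreover have "w \<notin> S" "u \<in> S"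
      using mem step[of w] k_u neq by auto
    ultimately have "\<exists>\<tau>. \<tau> permutes I \<and> edge_labels e I \<tau> + {#e w (\<rho>' w), e u (\<rho>' u)#} =
        edge_labels e I \<rho>' + {#e w u, e (\<rho>' w) (\<rho>' u)#}"
      by (rule edge_exchange_of_invariant_set[OF fin perm' SI _ sym w])
    then obtain \<tau> where \<tau>: "\<tau> permutes I" "edge_labels e I \<tau> + {#e w (\<rho>' w), e u (\<rho>' u)#} =
        edge_labels e I \<rho>' + {#e w u, e (\<rho>' w) (\<rho>' u)#}"
      by blast
    define P Q R where "P = {#e u (\<rho> w), e w (\<rho> u)#}" and "Q = {#e u w, e (\<rho> u) (\<rho> w)#}"
      and "R = {#e u (\<rho> u), e w (\<rho> w)#}"
    have "edge_labels e I \<tau> + P = edge_labels e I \<rho>' + Q"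
      using \<tau>(2) by (simp add: \<rho>'_def P_def Q_def sym[of w u] add_mset_commute)
    moreover have "edge_labels e I \<rho>' + R = edge_labels e I \<rho> + P"
      unfolding \<rho>'_def P_def R_def by (rule edge_labels_swap[OF fin u w neq])
    ultimately have "edge_labels e I \<tau> + R + P = edge_labels e I \<rho> + Q + P"
      by (metis add.assoc add.commute)
    then have "edge_labels e I \<tau> + R = edge_labels e I \<rho> + Q"
      by (rule add_right_imp_eq)
    then have "edge_labels e I \<tau> + {#e u (\<rho> u), e w (\<rho> w)#} =
        edge_labels e I \<rho> + {#e u w, e (\<rho> u) (\<rho> w)#}"
      unfolding Q_def R_def .
    then show ?thesis
      using \<tau>(1) by blast
  qed
qed

section \<open>Hall's theorem for cyclic groups\<close>

definition difference_mset :: "nat \<Rightarrow> int multiset \<Rightarrow> bool" where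
  "difference_mset n M \<longleftrightarrow> (\<exists>\<sigma>. \<sigma> permutes {0..<int n} \<and>
     M = image_mset (\<lambda>x. (x - \<sigma> x) mod int n) (mset_set {0..<int n}))"

lemma reflection_permutes:
  fixes K :: int
  assumes "n > 0"
  shows "(\<lambda>x. if x \<in> {0..<int n} then (K - x) mod int n else x) permutes {0..<int n}"
    (is "?r permutes _")
proof -
  have "?r (?r x) = x" if "x \<in> {0..<int n}" for x
    using that assms by (simp add: mod_diff_right_eq)
  then have "bij_betw ?r {0..<int n} {0..<int n}"
    using assms by (intro bij_betw_byWitness[of _ ?r]) auto
  then show ?thesis
    by (rule bij_imp_permutes) auto
qed

text \<open>
  Writing \<open>\<rho> x = K - \<sigma> x\<close> turns a difference \<open>x - \<sigma> x\<close> into the edge label \<open>x + \<rho> x - K\<close>, which is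
  symmetric in its two ends. The 2-opt move then trades the differences \<open>a\<close> and \<open>b\<close>, attained at \<open>u\<close>
  and \<open>w\<close>, for two new ones with the same sum, and \<open>K = u + w - c\<close> makes the label of the new edge
  between \<open>u\<close> and \<open>w\<close> equal to the desired value \<open>c\<close>.
\<close>

lemma difference_mset_exchange:
  assumes n: "n > 0" and M: "difference_mset n (add_mset a (add_mset b A))" and c: "c \<in> {0..<int n}"
  shows "difference_mset n (add_mset c (add_mset ((a + b - c) mod int n) A))"
proof -
  define I where "I = {0..<int n}"
  have fin: "finite I"
    by (simp add: I_def)
  obtain \<sigma> where \<sigma>: "\<sigma> permutes I"
    and \<sigma>M: "image_mset (\<lambda>x. (x - \<sigma> x) mod int n) (mset_set I) = add_mset a (add_mset b A)"
    using M unfolding difference_mset_def I_def by metis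
  obtain u where u: "u \<in> I" "a = (u - \<sigma> u) mod int n"
    using fin \<sigma>M by (metis (no_types, lifting) finite_set_mset_mset_set imageE set_image_mset union_single_eq_member)
  have "mset_set I = add_mset u (mset_set (I - {u}))"
    using fin u(1) by (simp add: mset_set.remove)
  then have "image_mset (\<lambda>x. (x - \<sigma> x) mod int n) (mset_set (I - {u})) = add_mset b A"
    using \<sigma>M u(2) by simp
  then obtain w where w: "w \<in> I - {u}" "b = (w - \<sigma> w) mod int n"
    using fin by (metis (no_types, lifting) finite_Diff finite_set_mset_mset_set imageE set_image_mset union_single_eq_member)
  define K where "K = u + w - c"
  define r where "r = (\<lambda>x. if x \<in> I then (K - x) mod int n else x)"
  define e where "e = (\<lambda>x y. (x + y - K) mod int n)"
  have r: "r permutes I"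
    unfolding r_def I_def by (rule reflection_permutes[OF n])
  have e_r: "e x (r (\<pi> x)) = (x - \<pi> x) mod int n" if "x \<in> I" "\<pi> permutes I" for x \<pi>
  proof -
    have "e x (r (\<pi> x)) = (x - K + (K - \<pi> x) mod int n) mod int n"
      using permutes_in_image[OF that(2)] that(1) by (simp add: e_def r_def algebra_simps)
    also have "\<dots> = (x - \<pi> x) mod int n"
      by (simp add: mod_add_right_eq)
    finally show ?thesis .
  qed
  have labels: "edge_labels e I (r \<circ> \<pi>) = image_mset (\<lambda>x. (x - \<pi> x) mod int n) (mset_set I)"
    if "\<pi> permutes I" for \<pi>
    unfolding edge_labels_def using fin e_r[OF _ that] by (intro image_mset_cong) auto
  obtain \<tau> where \<tau>: "\<tau> permutes I"
      "edge_labels e I \<tau> + {#e u (r (\<sigma> u)), e w (r (\<sigma> w))#} =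
       edge_labels e I (r \<circ> \<sigma>) + {#e u w, e (r (\<sigma> u)) (r (\<sigma> w))#}"
    using edge_exchange[OF fin permutes_compose[OF \<sigma> r], of e u w] u w
    by (auto simp: e_def add.commute)
  have "e u w = c"
    using c by (simp add: e_def K_def)
  moreover have "e (r (\<sigma> u)) (r (\<sigma> w)) = (a + b - c) mod int n"
  proof -
    have "\<sigma> u \<in> I" "\<sigma> w \<in> I"
      using permutes_in_image[OF \<sigma>] u w by auto
    then have "e (r (\<sigma> u)) (r (\<sigma> w)) = ((K - \<sigma> u) mod int n + (K - \<sigma> w) mod int n - K) mod int n"
      by (simp add: e_def r_def)
    also have "\<dots> = ((K - \<sigma> u) + (K - \<sigma> w) - K) mod int n"
      by (intro mod_diff_cong mod_add_cong) simp_all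
    also have "\<dots> = (u - \<sigma> u + (w - \<sigma> w) - c) mod int n"
      by (simp add: K_def algebra_simps)
    also have "\<dots> = (a + b - c) mod int n"
      unfolding u(2) w(2) by (intro mod_diff_cong mod_add_cong) simp_all
    finally show ?thesis .
  qed
  moreover have "e u (r (\<sigma> u)) = a" "e w (r (\<sigma> w)) = b"
    using e_r \<sigma> u w by auto
  ultimately have "edge_labels e I \<tau> + {#a, b#} = A + {#c, (a + b - c) mod int n#} + {#a, b#}"
    using \<tau>(2) labels[OF \<sigma>] \<sigma>M by simp
  then have \<tau>_labels: "edge_labels e I \<tau> = A + {#c, (a + b - c) mod int n#}"
    by (rule add_right_imp_eq)
  have rr: "r \<circ> (r \<circ> \<tau>) = \<tau>"
  proof
    fix x show "(r \<circ> (r \<circ> \<tau>)) x = \<tau> x"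
      using n by (auto simp: r_def I_def mod_diff_right_eq)
  qed
  have "r \<circ> \<tau> permutes I"
    using \<tau>(1) r by (rule permutes_compose)
  moreover have "image_mset (\<lambda>x. (x - (r \<circ> \<tau>) x) mod int n) (mset_set I) =
      add_mset c (add_mset ((a + b - c) mod int n) A)"
    using labels[OF calculation] \<tau>_labels unfolding rr by simp
  ultimately show ?thesis
    unfolding difference_mset_def I_def by metis
qed

text \<open>
  The identity permutation realises the multiset of \<open>n\<close> zeros. The elements of \<open>B\<close> are brought in one at
  a time; each exchange uses up a zero, and the extra entry keeps track of minus the running sum.
\<close>

lemma difference_mset_completion:
  assumes "size B < n" and "set_mset B \<subseteq> {0..<int n}"
  shows "difference_mset n (add_mset (- sum_mset B mod int n) (B + replicate_mset (n - 1 - size B) 0))"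
  using assms
proof (induction B)
  case empty
  have "image_mset (\<lambda>x. (x - id x) mod int n) (mset_set {0..<int n}) = replicate_mset n 0"
    by (simp add: image_mset_const_eq)
  also have "\<dots> = add_mset 0 (replicate_mset (n - 1) 0)"
    using empty by (cases n) auto
  finally have "add_mset (- sum_mset {#} mod int n) ({#} + replicate_mset (n - 1 - size {#}) 0) =
      image_mset (\<lambda>x. (x - id x) mod int n) (mset_set {0..<int n})"
    by simp
  then show ?case
    unfolding difference_mset_def using permutes_id by blast
next
  case (add d B)
  define k where "k = n - 1 - size (add_mset d B)"
  have "n - 1 - size B = Suc k"
    using add.prems by (simp add: k_def)
  then have "difference_mset n (add_mset (- sum_mset B mod int n) (add_mset 0 (B + replicate_mset k 0)))"
    using add by (simp add: add.commute)
  then have "difference_mset n (add_mset d (add_mset ((- sum_mset B mod int n + 0 - d) mod int n)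
      (B + replicate_mset k 0)))"
    using add.prems by (intro difference_mset_exchange) auto
  moreover have "(- sum_mset B mod int n + 0 - d) mod int n = - sum_mset (add_mset d B) mod int n"
  proof -
    have "- sum_mset (add_mset d B) = - sum_mset B - d"
      by simp
    then show ?thesis
      by (metis add.right_neutral mod_diff_left_eq)
  qed
  ultimately show ?case
    by (simp add: k_def add_mset_commute)
qed

text \<open>
  Hall's theorem for cyclic groups. Differences of a permutation sum to zero because \<open>\<sigma>\<close> only rearranges
  the summands. Conversely, once all but one element of \<open>M\<close> have been brought in, the extra entry of the
  previous lemma is forced to be the last one.
\<close>

theorem difference_mset_iff_zero_sum:
  assumes n: "n > 0"
  shows "difference_mset n M \<longleftrightarrow> size M = n \<and> set_mset M \<subseteq> {0..<int n} \<and> int n dvd sum_mset M"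
proof
  assume "difference_mset n M"
  then obtain \<sigma> where \<sigma>: "\<sigma> permutes {0..<int n}"
    and M: "M = image_mset (\<lambda>x. (x - \<sigma> x) mod int n) (mset_set {0..<int n})"
    unfolding difference_mset_def by blast
  have "sum_mset M = (\<Sum>x\<in>{0..<int n}. (x - \<sigma> x) mod int n)"
    unfolding M by (simp add: sum_unfold_sum_mset)
  also have "\<dots> mod int n = (\<Sum>x\<in>{0..<int n}. x - \<sigma> x) mod int n"
    by (simp add: mod_sum_eq)
  also have "(\<Sum>x\<in>{0..<int n}. x - \<sigma> x) = 0"
    using sum.permute[OF \<sigma>, of "\<lambda>x. x"] by (simp add: sum_subtractf o_def)
  finally show "size M = n \<and> set_mset M \<subseteq> {0..<int n} \<and> int n dvd sum_mset M"
    using n unfolding M by auto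
next
  assume M: "size M = n \<and> set_mset M \<subseteq> {0..<int n} \<and> int n dvd sum_mset M"
  then obtain d B where dB: "M = add_mset d B"
    using n by (metis multiset_nonemptyE mset_add size_empty less_irrefl)
  have "- sum_mset B - d = - sum_mset M"
    by (simp add: dB)
  then have "- sum_mset B mod int n = d mod int n"
    using M by (metis dvd_minus_iff mod_eq_dvd_iff)
  then show "difference_mset n M"
    using difference_mset_completion[of B n] M dB by auto
qed

section \<open>Monomials of the group permanent\<close>

definition mset_monomial :: "'a multiset \<Rightarrow> 'a \<Rightarrow>\<^sub>0 nat" where
  "mset_monomial M = (\<Sum>x\<in>#M. Poly_Mapping.single x 1)"

lemma lookup_mset_monomial: "Poly_Mapping.lookup (mset_monomial M) x = count M x"
  by (induction M) (auto simp: mset_monomial_def lookup_add lookup_single)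

lemma inj_mset_monomial: "inj mset_monomial"
  by (metis injI lookup_mset_monomial multiset_eqI)

lemma prod_mvar:
  assumes "finite I"
  shows "(\<Prod>i\<in>I. mvar (c i)) = Poly_Mapping.single (mset_monomial (image_mset c (mset_set I))) 1"
  using assms
  by (induction I) (auto simp: mvar_def mset_monomial_def mult_single)

text \<open>
  All coefficients are positive, so nothing cancels.
\<close>

lemma keys_sum_single_one:
  assumes "finite P"
  shows "Poly_Mapping.keys (\<Sum>s\<in>P. Poly_Mapping.single (m s) (1::int)) = m ` P"
proof -
  have "Poly_Mapping.lookup (\<Sum>s\<in>P. Poly_Mapping.single (m s) (1::int)) k = int (card {s \<in> P. k = m s})" for k
    using assms by (simp add: lookup_sum lookup_single when_def sum.If_cases Int_def)
  then show ?thesis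
    using assms by (auto simp: in_keys_iff card_eq_0_iff)
qed

theorem num_monomials_eq_zero_sum_multisets:
  assumes n: "n > 0"
  shows "num_monomials (group_permanent (integer_mod_group n)) =
    card {M. size M = n \<and> set_mset M \<subseteq> {0..<int n} \<and> int n dvd sum_mset M}"
proof -
  define I where "I = {0..<int n}"
  have I: "carrier (integer_mod_group n) = I" and fin: "finite I"
    using n by (auto simp: carrier_integer_mod_group I_def)
  define D where "D = (\<lambda>\<sigma>. image_mset (\<lambda>x. (x - \<sigma> x) mod int n) (mset_set I))"
  have entry: "group_matrix (integer_mod_group n) x (\<sigma> x) = mvar ((x - \<sigma> x) mod int n)"
    if "x \<in> I" "\<sigma> permutes I" for x \<sigma>
    using that permutes_in_image[OF that(2), of x]
    by (simp add: group_matrix_def I inv_integer_mod_group mod_simps)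
  have "group_permanent (integer_mod_group n) =
      (\<Sum>\<sigma> | \<sigma> permutes I. \<Prod>x\<in>I. mvar ((x - \<sigma> x) mod int n))"
    unfolding group_permanent_def permanent_on_def I
    by (intro sum.cong prod.cong refl entry) auto
  also have "\<dots> = (\<Sum>\<sigma> | \<sigma> permutes I. Poly_Mapping.single (mset_monomial (D \<sigma>)) 1)"
    by (simp add: prod_mvar[OF fin] D_def)
  finally have "Poly_Mapping.keys (group_permanent (integer_mod_group n)) =
      mset_monomial ` D ` {\<sigma>. \<sigma> permutes I}"
    using keys_sum_single_one[OF finite_permutations[OF fin]] by (simp add: image_image)
  also have "D ` {\<sigma>. \<sigma> permutes I} = {M. difference_mset n M}"
    by (auto simp: difference_mset_def D_def I_def)
  finally show ?thesis
    unfolding num_monomials_def difference_mset_iff_zero_sum[OF n]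
    using card_image[OF inj_on_subset[OF inj_mset_monomial subset_UNIV]] by metis
qed

section \<open>Complete homogeneous polynomials at roots of unity\<close>

unbundle fps_syntax

text \<open>
  The complete homogeneous symmetric polynomial of degree \<open>k\<close>, evaluated at the family of numbers \<open>w\<close>.
\<close>

definition complete_homogeneous :: "'a set \<Rightarrow> ('a \<Rightarrow> 'b) \<Rightarrow> nat \<Rightarrow> 'b :: comm_ring_1" where
  "complete_homogeneous A w k = (\<Sum>M | size M = k \<and> set_mset M \<subseteq> A. \<Prod>x\<in>#M. w x)"

lemma finite_multisets_size:
  assumes "finite A"
  shows "finite {M. size M = k \<and> set_mset M \<subseteq> A}"
proof -
  have "{M. size M = k \<and> set_mset M \<subseteq> A} \<subseteq> mset ` {xs. set xs \<subseteq> A \<and> length xs = k}"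
  proof
    fix M assume "M \<in> {M. size M = k \<and> set_mset M \<subseteq> A}"
    moreover obtain xs where "mset xs = M"
      using ex_mset by blast
    ultimately show "M \<in> mset ` {xs. set xs \<subseteq> A \<and> length xs = k}"
      by (intro image_eqI[of _ _ xs]) auto
  qed
  then show ?thesis
    by (rule finite_subset) (rule finite_imageI[OF finite_lists_length_eq[OF assms]])
qed

lemma complete_homogeneous_0 [simp]: "complete_homogeneous A w 0 = 1"
proof -
  have "{M. size M = 0 \<and> set_mset M \<subseteq> A} = {{#}}"
    by auto
  then show ?thesis
    by (simp add: complete_homogeneous_def)
qed

text \<open>
  Sorting multisets by whether they contain \<open>a\<close> gives the recurrence behind the generating function.
\<close>

lemma complete_homogeneous_insert_Suc:
  fixes A :: "'a set"
  assumes "finite A" "a \<notin> A"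
  shows "complete_homogeneous (insert a A) w (Suc k) =
    complete_homogeneous A w (Suc k) + w a * complete_homogeneous (insert a A) w k"
proof -
  define S where "S = (\<lambda>(B :: 'a set) k. {M. size M = k \<and> set_mset M \<subseteq> B})"
  have ch: "complete_homogeneous B w k = (\<Sum>M\<in>S B k. \<Prod>x\<in>#M. w x)" for B k
    by (simp add: complete_homogeneous_def S_def)
  have fin: "finite (S B k)" if "finite B" for B k
    using finite_multisets_size[OF that] by (simp add: S_def)
  have union: "S (insert a A) (Suc k) = S A (Suc k) \<union> add_mset a ` S (insert a A) k"
  proof (intro Set.set_eqI iffI)
    fix M assume M: "M \<in> S (insert a A) (Suc k)"
    show "M \<in> S A (Suc k) \<union> add_mset a ` S (insert a A) k"
    proof (cases "a \<in># M")
      case True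
      then obtain B where "M = add_mset a B"
        by (metis mset_add)
      then show ?thesis
        using M by (auto simp: S_def)
    qed (use M in \<open>auto simp: S_def\<close>)
  qed (auto simp: S_def)
  have disjoint: "S A (Suc k) \<inter> add_mset a ` S (insert a A) k = {}"
    using assms(2) by (auto simp: S_def)
  have shift: "(\<Sum>M\<in>add_mset a ` S (insert a A) k. \<Prod>x\<in>#M. w x) =
      w a * (\<Sum>M\<in>S (insert a A) k. \<Prod>x\<in>#M. w x)"
    by (subst sum.reindex) (auto simp: sum_distrib_left inj_on_def)
  have "(\<Sum>M\<in>S (insert a A) (Suc k). \<Prod>x\<in>#M. w x) = (\<Sum>M\<in>S A (Suc k). \<Prod>x\<in>#M. w x) +
      (\<Sum>M\<in>add_mset a ` S (insert a A) k. \<Prod>x\<in>#M. w x)"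
    unfolding union using assms(1) by (intro sum.union_disjoint finite_imageI fin disjoint) simp_all
  then show ?thesis
    unfolding ch shift .
qed

lemma complete_homogeneous_empty_Suc:
  fixes w :: "'a \<Rightarrow> 'b :: comm_ring_1"
  shows "complete_homogeneous {} w (Suc k) = 0"
  unfolding complete_homogeneous_def by (rule sum.neutral) auto

lemma complete_homogeneous_gf:
  assumes "finite A"
  shows "Abs_fps (complete_homogeneous A w) * (\<Prod>a\<in>A. 1 - fps_const (w a) * fps_X) = 1"
  using assms
proof (induction A)
  case empty
  have "Abs_fps (complete_homogeneous {} w) = 1"
  proof (rule fps_ext)
    fix k show "Abs_fps (complete_homogeneous {} w) $ k = 1 $ k"
      by (cases k) (simp_all add: complete_homogeneous_empty_Suc)
  qed
  then show ?case
    by simp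
next
  case (insert a A)
  define H where "H = Abs_fps (complete_homogeneous (insert a A) w)"
  have "H * (1 - fps_const (w a) * fps_X) = Abs_fps (complete_homogeneous A w)"
  proof (rule fps_ext)
    have *: "H * (1 - fps_const (w a) * fps_X) = H - fps_const (w a) * (H * fps_X)"
      by (simp only: right_diff_distrib mult_1_right mult.left_commute)
    fix k show "(H * (1 - fps_const (w a) * fps_X)) $ k = Abs_fps (complete_homogeneous A w) $ k"
      unfolding * using insert.hyps by (cases k) (simp_all add: H_def complete_homogeneous_insert_Suc)
  qed
  moreover have "H * (\<Prod>b\<in>insert a A. 1 - fps_const (w b) * fps_X) =
      H * (1 - fps_const (w a) * fps_X) * (\<Prod>b\<in>A. 1 - fps_const (w b) * fps_X)"
    using insert.hyps by (simp add: mult.assoc)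
  ultimately show ?case
    using insert.IH by (simp add: H_def)
qed

text \<open>
  Both sides have degree at most \<open>e\<close>, and they agree at \<open>0\<close> and at the \<open>e\<close> distinct powers of \<open>z\<close>.
\<close>

lemma prod_linear_roots_of_unity:
  fixes z :: "'a :: idom"
  assumes e: "e > 0" and ord: "\<And>i. z ^ i = 1 \<longleftrightarrow> e dvd i"
  shows "(\<Prod>i<e. [:1, - (z ^ i):]) = 1 - monom 1 e"
proof (rule poly_eqI_degree)
  define A where "A = insert 0 ((\<lambda>i. z ^ i) ` {..<e})"
  have z0: "z \<noteq> 0"
    using ord[of e] e by (auto simp: power_0_left)
  have "inj_on (\<lambda>i. z ^ i) {..<e}"
  proof (rule linorder_inj_onI')
    fix i j assume ij: "i \<in> {..<e}" "j \<in> {..<e}" "i < j"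
    have "z ^ j = z ^ i * z ^ (j - i)"
      using ij by (simp flip: power_add)
    moreover have "z ^ (j - i) \<noteq> 1"
      using ord[of "j - i"] ij by (auto dest: dvd_imp_le)
    ultimately show "z ^ i \<noteq> z ^ j"
      using z0 by auto
  qed
  then have card: "card A = Suc e"
    using z0 by (simp add: A_def card_image image_iff)
  show "poly (\<Prod>i<e. [:1, - (z ^ i):]) x = poly (1 - monom 1 e) x" if x: "x \<in> A" for x
  proof (cases "x = 0")
    case False
    then obtain k where k: "k < e" "x = z ^ k"
      using x by (auto simp: A_def)
    \<comment> \<open>The factor vanishing at \<open>z ^ k\<close> is the one with exponent \<open>- k\<close> modulo \<open>e\<close>.\<close>
    define j where "j = (e - k) mod e"
    have "j < e" "e dvd j + k"
      using k e by (auto simp: j_def mod_add_left_eq dvd_eq_mod_eq_0)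
    then have "poly [:1, - (z ^ j):] x = 0"
      using k ord[of "j + k"] by (simp add: power_add mult.commute)
    then have "poly (\<Prod>i<e. [:1, - (z ^ i):]) x = 0"
      using \<open>j < e\<close> by (auto simp: poly_prod)
    moreover have "x ^ e = 1"
      using k ord[of "k * e"] by (simp add: power_mult)
    ultimately show ?thesis
      by (simp add: poly_monom)
  qed (use e in \<open>simp add: poly_prod poly_monom\<close>)
  have "degree (\<Prod>i<e. [:1, - (z ^ i):]) \<le> (\<Sum>i<e. degree [:1, - (z ^ i):])"
    using degree_prod_sum_le[of "{..<e}" "\<lambda>i. [:1, - (z ^ i):]"] by (simp add: o_def)
  also have "\<dots> \<le> (\<Sum>i<e. 1)"
    by (intro sum_mono) auto
  finally show "degree (\<Prod>i<e. [:1, - (z ^ i):]) < card A"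
    using card by simp
  show "degree (1 - monom (1::'a) e) < card A"
    using card degree_diff_le[of 1 e "monom (1::'a) e"] degree_monom_le[of "1::'a" e] by simp
qed

lemma fps_prod_roots_of_unity:
  fixes z :: "'a :: field"
  assumes e: "e > 0" and ord: "\<And>i. z ^ i = 1 \<longleftrightarrow> e dvd i"
  shows "(\<Prod>i<d * e. 1 - fps_const (z ^ i) * fps_X) = (1 - fps_X ^ e) ^ d"
proof -
  define h where "h = (\<lambda>i. 1 - fps_const (z ^ i) * fps_X)"
  have "prod h {..<e} = fps_of_poly (\<Prod>i<e. [:1, - (z ^ i):])"
    by (simp add: fps_of_poly_prod fps_of_poly_linear' h_def fps_const_neg[symmetric] del: fps_const_neg)
  also have "\<dots> = 1 - fps_X ^ e"
    unfolding prod_linear_roots_of_unity[OF e ord]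
    by (simp add: fps_of_poly_diff fps_of_poly_monom')
  finally have period: "prod h {..<e} = 1 - fps_X ^ e" .
  have "prod h {..<d * e} = (\<Prod>m<d. prod h {m * e..<m * e + e})"
    by (simp add: prod.nat_group)
  also have "\<dots> = (\<Prod>m<d. prod h {..<e})"
  proof (rule prod.cong)
    fix m
    have "prod h {m * e..<m * e + e} = (\<Prod>i<e. h (m * e + i))"
      by (rule prod.reindex_bij_witness[of _ "\<lambda>i. m * e + i" "\<lambda>i. i - m * e"]) auto
    also have "\<dots> = prod h {..<e}"
      using ord[of "m * e"] by (simp add: h_def power_add)
    finally show "prod h {m * e..<m * e + e} = prod h {..<e}" .
  qed simp
  also have "\<dots> = (1 - fps_X ^ e) ^ d"
    unfolding period by simp
  finally show ?thesis
    unfolding h_def .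
qed

text \<open>
  The generating function is \<open>(1 - X ^ e) ^ (- d)\<close>, that is \<open>(1 - X) ^ (- d)\<close> with \<open>X ^ e\<close>
  substituted for \<open>X\<close>.
\<close>

lemma complete_homogeneous_roots_of_unity:
  fixes z :: "'a :: field_char_0"
  assumes e: "e > 0" and ord: "\<And>i. z ^ i = 1 \<longleftrightarrow> e dvd i" and d: "d > 0"
  shows "complete_homogeneous {..<d * e} (\<lambda>i. z ^ i) (k * e) = of_nat ((d + k - 1) choose k)"
proof -
  define B where "B = Abs_fps (\<lambda>k. of_nat ((d + k - 1) choose k) :: 'a)"
  have "B = inverse ((1 - fps_X) ^ d)"
    using one_minus_const_fps_X_neg_power'[OF d, of "1::'a"] by (simp add: B_def)
  then have "B * (1 - fps_X) ^ d = 1"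
    by (simp add: inverse_mult_eq_1)
  then have "(B * (1 - fps_X) ^ d) oo fps_X ^ e = 1 oo fps_X ^ e"
    by simp
  then have "(B oo fps_X ^ e) * (1 - fps_X ^ e) ^ d = 1"
    using e by (simp add: fps_compose_mult_distrib fps_compose_power[symmetric] fps_compose_sub_distrib)
  moreover have "Abs_fps (complete_homogeneous {..<d * e} (\<lambda>i. z ^ i)) * (1 - fps_X ^ e) ^ d = 1"
    using complete_homogeneous_gf[of "{..<d * e}" "\<lambda>i. z ^ i"] fps_prod_roots_of_unity[OF e ord, of d]
    by simp
  moreover have "(1 - fps_X ^ e :: 'a fps) ^ d \<noteq> 0"
    using calculation by force
  ultimately have "Abs_fps (complete_homogeneous {..<d * e} (\<lambda>i. z ^ i)) = B oo fps_X ^ e"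
    by (metis (no_types) mult_right_cancel)
  then have "complete_homogeneous {..<d * e} (\<lambda>i. z ^ i) (k * e) = (B oo fps_X ^ e) $ (k * e)"
    by (metis fps_nth_Abs_fps)
  also have "\<dots> = (\<Sum>i = 0..k * e. if i = k then B $ i else 0)"
    unfolding fps_compose_nth using e by (intro sum.cong) (auto simp: fps_X_power_nth mult.commute[of e] simp flip: power_mult)
  also have "\<dots> = B $ k"
    using e by simp
  finally show ?thesis
    by (simp add: B_def)
qed

section \<open>Counting zero-sum multisets with characters\<close>

lemma complex_primitive_root:
  assumes "n > 0"
  obtains \<omega> :: complex where "\<And>i. \<omega> ^ i = 1 \<longleftrightarrow> n dvd i"
proof
  fix i
  have "cis (2 * pi / real n) ^ i = 1 \<longleftrightarrow> (\<exists>k::int. 2 * pi * real i / real n = of_int k * 2 * pi)"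
    unfolding DeMoivre by (simp add: complex_eq_iff mult.commute[of "real i"] flip: cos_one_2pi_int)
      (metis cos_one_sin_zero)
  also have "\<dots> \<longleftrightarrow> (\<exists>k::int. real i = of_int k * real n)"
    using assms by (simp add: field_simps)
  also have "\<dots> \<longleftrightarrow> (\<exists>k::int. int i = k * int n)"
    by (metis of_int_eq_iff of_int_mult of_int_of_nat_eq)
  also have "\<dots> \<longleftrightarrow> n dvd i"
    by (metis dvd_def int_dvd_int_iff mult.commute)
  finally show "cis (2 * pi / real n) ^ i = 1 \<longleftrightarrow> n dvd i" .
qed

lemma root_of_unity_power_eq_1_iff:
  fixes \<omega> :: "'a :: monoid_mult"
  assumes n: "n > 0" and ord: "\<And>i. \<omega> ^ i = 1 \<longleftrightarrow> n dvd i"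
  shows "(\<omega> ^ j) ^ i = 1 \<longleftrightarrow> n div gcd j n dvd i"
proof -
  define g where "g = gcd j n"
  have g: "g > 0" "g * (j div g) = j" "g * (n div g) = n"
    using n by (simp_all add: g_def)
  have "coprime (n div g) (j div g)"
    using n by (simp add: g_def gcd.commute[of j] div_gcd_coprime)
  then have "n div g dvd i \<longleftrightarrow> n div g dvd (j div g) * i"
    by (simp add: coprime_dvd_mult_right_iff)
  also have "\<dots> \<longleftrightarrow> g * (n div g) dvd g * ((j div g) * i)"
    using g(1) by simp
  also have "\<dots> \<longleftrightarrow> n dvd j * i"
    unfolding mult.assoc[symmetric] g(2,3) ..
  finally have "n dvd j * i \<longleftrightarrow> n div gcd j n dvd i"
    by (simp add: g_def)
  then show ?thesis
    by (simp add: ord flip: power_mult)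
qed

lemma sum_root_of_unity_powers:
  fixes \<omega> :: "'a :: field"
  assumes ord: "\<And>i. \<omega> ^ i = 1 \<longleftrightarrow> n dvd i"
  shows "(\<Sum>j<n. (\<omega> ^ j) ^ s) = (if n dvd s then of_nat n else 0)"
proof (cases "n dvd s")
  case True
  then have "(\<omega> ^ j) ^ s = 1" for j
    using ord by (simp flip: power_mult)
  then show ?thesis
    using True by simp
next
  case False
  have "(\<Sum>j<n. (\<omega> ^ j) ^ s) = (\<Sum>j<n. (\<omega> ^ s) ^ j)"
    by (simp add: mult.commute flip: power_mult)
  also have "\<dots> = ((\<omega> ^ s) ^ n - 1) / (\<omega> ^ s - 1)"
    using False ord by (intro geometric_sum) simp
  also have "(\<omega> ^ s) ^ n = 1"
    using ord by (simp flip: power_mult)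
  finally show ?thesis
    using False by simp
qed

text \<open>
  For \<open>d > 0\<close> this is half of the central binomial coefficient \<open>(2 * d) choose d\<close>.
\<close>

definition central_binomial :: "nat \<Rightarrow> nat" where
  "central_binomial d = (2 * d - 1) choose (d - 1)"

text \<open>
  Summing the characters \<open>x \<mapsto> \<omega> ^ (j * x)\<close> of the cyclic group over \<open>j\<close> detects zero-sum multisets. For
  fixed \<open>j\<close> with \<open>d = gcd j n\<close>, the character sum over all multisets of size \<open>n\<close> is a complete
  homogeneous polynomial evaluated at the roots of unity whose order divides \<open>n / d\<close>, each taken \<open>d\<close> times.
\<close>

theorem zero_sum_multisets_count:
  assumes n: "n > 0"
  shows "n * card {M. size M = n \<and> set_mset M \<subseteq> {0..<int n} \<and> int n dvd sum_mset M} =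
    (\<Sum>j<n. central_binomial (gcd j n))"
proof -
  define S where "S = {M. size M = n \<and> set_mset M \<subseteq> {..<n}}"
  have finS: "finite S"
    unfolding S_def by (rule finite_multisets_size) simp
  obtain \<omega> :: complex where ord: "\<And>i. \<omega> ^ i = 1 \<longleftrightarrow> n dvd i"
    using complex_primitive_root[OF n] by blast
  have char_sum: "(\<Sum>M\<in>S. (\<omega> ^ j) ^ sum_mset M) = of_nat (central_binomial (gcd j n))" for j
  proof -
    define d where "d = gcd j n"
    define e where "e = n div d"
    have d: "d > 0" and de: "d * e = n" and e: "e > 0"
      using n by (auto simp: d_def e_def div_greater_zero_iff gcd_le2_nat)
    have "(\<Prod>x\<in>#M. (\<omega> ^ j) ^ x) = (\<omega> ^ j) ^ sum_mset M" for M
      by (induction M) (simp_all add: power_add)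
    then have "(\<Sum>M\<in>S. (\<omega> ^ j) ^ sum_mset M) = complete_homogeneous {..<d * e} (\<lambda>i. (\<omega> ^ j) ^ i) (d * e)"
      by (simp add: complete_homogeneous_def S_def de)
    also have "\<dots> = of_nat ((d + d - 1) choose d)"
      using root_of_unity_power_eq_1_iff[OF n ord, of j] e d
      by (intro complete_homogeneous_roots_of_unity) (simp_all add: e_def d_def)
    also have "(d + d - 1) choose d = central_binomial d"
      using d binomial_symmetric[of d "2 * d - 1"] by (simp add: central_binomial_def mult_2)
    finally show ?thesis
      by (simp add: d_def)
  qed
  have "of_nat (\<Sum>j<n. central_binomial (gcd j n)) = (\<Sum>j<n. \<Sum>M\<in>S. (\<omega> ^ j) ^ sum_mset M)"
    by (simp add: char_sum)
  also have "\<dots> = (\<Sum>M\<in>S. \<Sum>j<n. (\<omega> ^ j) ^ sum_mset M)"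
    by (rule sum.swap)
  also have "\<dots> = (\<Sum>M\<in>S. if n dvd sum_mset M then of_nat n else 0)"
    using ord by (intro sum.cong refl sum_root_of_unity_powers) simp
  also have "\<dots> = of_nat (n * card {M \<in> S. n dvd sum_mset M})"
    using finS by (simp add: sum.If_cases Int_def)
  finally have "(\<Sum>j<n. central_binomial (gcd j n)) = n * card {M \<in> S. n dvd sum_mset M}"
    by (simp only: of_nat_eq_iff)
  moreover have "bij_betw (image_mset int) {M \<in> S. n dvd sum_mset M}
      {M. size M = n \<and> set_mset M \<subseteq> {0..<int n} \<and> int n dvd sum_mset M}"
  proof (rule bij_betw_byWitness[where f' = "image_mset nat"])
    have "image_mset int (image_mset nat M) = M" if "set_mset M \<subseteq> {0..<int n}" for M
      using that by (simp add: multiset.map_comp) (metis (no_types, lifting) atLeastLessThan_iff comp_apply image_mset_cong int_nat_eq multiset.map_ident subsetD)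
    note * = this
    then show "\<forall>M\<in>{M. size M = n \<and> set_mset M \<subseteq> {0..<int n} \<and> int n dvd sum_mset M}.
        image_mset int (image_mset nat M) = M"
      by blast
    show "\<forall>M\<in>{M \<in> S. n dvd sum_mset M}. image_mset nat (image_mset int M) = M"
      by (simp add: multiset.map_comp o_def)
    show "image_mset int ` {M \<in> S. n dvd sum_mset M} \<subseteq>
        {M. size M = n \<and> set_mset M \<subseteq> {0..<int n} \<and> int n dvd sum_mset M}"
      by (auto simp: S_def subset_iff simp flip: of_nat_sum_mset)
    show "image_mset nat ` {M. size M = n \<and> set_mset M \<subseteq> {0..<int n} \<and> int n dvd sum_mset M} \<subseteq>
        {M \<in> S. n dvd sum_mset M}"
    proof safe
      fix M assume M: "set_mset M \<subseteq> {0..<int (size M)}" "n = size M" "int (size M) dvd sum_mset M"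
      then have "int (size M) dvd int (sum_mset (image_mset nat M))"
        unfolding of_nat_sum_mset using *[of M] by simp
      then show "size M dvd sum_mset (image_mset nat M)"
        by (simp only: int_dvd_int_iff)
      show "image_mset nat M \<in> S"
        using M by (auto simp: S_def subset_iff nat_less_iff)
    qed
  qed
  ultimately show ?thesis
    using bij_betw_same_card by fastforce
qed

section \<open>Jacobsthal's congruence for central binomial coefficients\<close>

text \<open>
  The right-hand side is the expansion of the product to first order in \<open>c\<close>.
\<close>

lemma prod_add_cong_square:
  fixes f :: "'a \<Rightarrow> int"
  assumes "finite A"
  shows "[(\<Prod>i\<in>A. f i + c) = prod f A + c * (\<Sum>i\<in>A. prod f (A - {i}))] (mod c\<^sup>2)"
  using assms
proof (induction A)
  case (insert a A)
  define E where "E = (\<Sum>i\<in>A. prod f (A - {i}))"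
  have "(\<Sum>i\<in>A. prod f (insert a A - {i})) = (\<Sum>i\<in>A. f a * prod f (A - {i}))"
  proof (rule sum.cong)
    fix i assume "i \<in> A"
    then have "insert a A - {i} = insert a (A - {i})"
      using insert.hyps by auto
    then show "prod f (insert a A - {i}) = f a * prod f (A - {i})"
      using insert.hyps by simp
  qed simp
  then have E': "(\<Sum>i\<in>insert a A. prod f (insert a A - {i})) = prod f A + f a * E"
    using insert.hyps by (simp add: sum_distrib_left E_def)
  have "[(\<Prod>i\<in>insert a A. f i + c) = (f a + c) * (prod f A + c * E)] (mod c\<^sup>2)"
    using insert by (simp add: cong_scalar_left E_def)
  also have "(f a + c) * (prod f A + c * E) = (prod f (insert a A) + c * (prod f A + f a * E)) + c\<^sup>2 * E"
    using insert.hyps by (simp add: algebra_simps power2_eq_square)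
  also have "[\<dots> = prod f (insert a A) + c * (prod f A + f a * E)] (mod c\<^sup>2)"
    by (simp add: cong_def)
  finally show ?case
    unfolding E' .
qed simp

lemma bij_betw_totatives_double:
  assumes "odd q" "q > 1"
  shows "bij_betw (\<lambda>i. 2 * i mod q) (totatives q) (totatives q)"
proof -
  have "inj_on (\<lambda>i. 2 * i mod q) (totatives q)"
  proof (rule inj_onI)
    fix i j assume ij: "i \<in> totatives q" "j \<in> totatives q" "2 * i mod q = 2 * j mod q"
    then have "[i = j] (mod q)"
      using assms(1) by (metis cong_def cong_mult_lcancel_nat coprime_left_2_iff_odd)
    then show "i = j"
      using ij totatives_less[OF _ assms(2)] by (simp add: cong_less_modulus_unique_nat)
  qed
  moreover have "2 * i mod q \<in> totatives q" if "i \<in> totatives q" for i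
  proof -
    have "coprime (2 * i) q"
      using that assms(1) by (simp add: in_totatives_iff)
    then have "coprime (2 * i mod q) q"
      using assms(2) by simp
    moreover from this have "2 * i mod q \<noteq> 0"
      using assms(2) by (metis coprime_0_left_iff nat_dvd_1_iff_1 less_irrefl)
    ultimately show ?thesis
      using assms(2) by (simp add: in_totatives_iff less_imp_le)
  qed
  ultimately show ?thesis
    by (simp add: bij_betw_def endo_inj_surj image_subset_iff)
qed

text \<open>
  Modulo \<open>q\<close>, the \<open>i\<close>-th summand is a unit, common to all \<open>i\<close>, times \<open>1 / i\<^sup>2\<close>. Replacing \<open>i\<close> by \<open>2 * i\<close>
  permutes the units and divides each summand by 4, so the sum \<open>S\<close> satisfies \<open>4 * S = S\<close>, and 3 is
  invertible. Working with the products \<open>g i\<close> themselves avoids choosing inverses modulo \<open>q\<close>.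
\<close>

lemma totatives_reciprocal_sum_dvd:
  assumes q: "q > 1" "odd q" "coprime q 3"
  defines "f \<equiv> \<lambda>i. int i * (int q - int i)"
  shows "int q dvd (\<Sum>i\<in>totatives q. prod f (totatives q - {i}))"
proof -
  define g where "g = (\<lambda>i. prod f (totatives q - {i}))"
  define D where "D = (\<lambda>i. 2 * i mod q)"
  have cop3: "coprime (int q) 3"
    using q(3) by (metis coprime_int_iff of_nat_numeral)
  have bij: "bij_betw D (totatives q) (totatives q)"
    unfolding D_def by (rule bij_betw_totatives_double[OF q(2,1)])
  have f_mod: "[f i = - (int i ^ 2)] (mod int q)" for i
    by (simp add: f_def cong_iff_dvd_diff power2_eq_square algebra_simps)
  have fg: "f i * g i = prod f (totatives q)" if "i \<in> totatives q" for i
    using that by (simp add: g_def prod.remove)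
  have quad: "[4 * g (D i) = g i] (mod int q)" if i: "i \<in> totatives q" for i
  proof -
    have "D i \<in> totatives q"
      using bij i by (auto simp: bij_betw_def)
    have "[int (D i) = 2 * int i] (mod int q)"
      by (simp add: D_def cong_def zmod_int)
    then have "[- (int (D i) ^ 2) = - ((2 * int i) ^ 2)] (mod int q)"
      by (simp only: cong_minus_minus_iff cong_pow)
    then have "[f (D i) = - ((2 * int i) ^ 2)] (mod int q)"
      using f_mod cong_trans by blast
    also have "- ((2 * int i) ^ 2) = 4 * (- (int i ^ 2))"
      by simp
    also have "[\<dots> = 4 * f i] (mod int q)"
      by (intro cong_scalar_left cong_sym[OF f_mod])
    finally have "[f (D i) * g (D i) = 4 * f i * g (D i)] (mod int q)"
      by (rule cong_scalar_right)
    then have "[f i * g i = f i * (4 * g (D i))] (mod int q)"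
      using fg[OF i] fg[OF \<open>D i \<in> totatives q\<close>] by (simp add: algebra_simps)
    moreover have "coprime (f i) (int q)"
    proof -
      have c: "coprime (int i) (int q)"
        using i by (simp add: in_totatives_iff)
      then have "coprime (- (int i ^ 2)) (int q)"
        by simp
      then show ?thesis
        using f_mod[of i] by (metis cong_imp_coprime cong_sym)
    qed
    ultimately show ?thesis
      by (simp add: cong_mult_lcancel cong_sym)
  qed
  have "(\<Sum>i\<in>totatives q. 4 * g (D i)) = 4 * (\<Sum>i\<in>totatives q. g i)"
    using sum.reindex_bij_betw[OF bij, of g] by (simp flip: sum_distrib_left)
  moreover have "[(\<Sum>i\<in>totatives q. 4 * g (D i)) = (\<Sum>i\<in>totatives q. g i)] (mod int q)"
    by (intro cong_sum quad)
  ultimately have "int q dvd 3 * (\<Sum>i\<in>totatives q. g i)"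
    by (simp add: cong_iff_dvd_diff)
  then show ?thesis
    using cop3 by (simp add: g_def coprime_dvd_mult_right_iff)
qed

text \<open>
  Pairing \<open>i\<close> with \<open>q - i\<close> gives \<open>(q + i) * (q + (q - i)) = i * (q - i) + 2 * q\<^sup>2\<close>, so the squares of the
  two products differ by \<open>2 * q\<^sup>2\<close> times the sum of the previous lemma, up to multiples of \<open>q ^ 4\<close>.
  Hence \<open>q ^ 3\<close> divides the difference of squares \<open>(X + Y) * (X - Y)\<close>. Since \<open>X + Y\<close> is congruent to the
  unit \<open>2 * Y\<close> modulo \<open>q\<close>, the other factor takes all of \<open>q ^ 3\<close>.
\<close>

lemma totatives_shifted_prod_cong:
  assumes q: "q > 1" "odd q" "coprime q 3"
  shows "[(\<Prod>i\<in>totatives q. int q + int i) = (\<Prod>i\<in>totatives q. int i)] (mod int q ^ 3)"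
proof -
  define R where "R = totatives q"
  define X where "X = (\<Prod>i\<in>R. int q + int i)"
  define Y where "Y = (\<Prod>i\<in>R. int i)"
  define f where "f = (\<lambda>i. int i * (int q - int i))"
  define E where "E = (\<Sum>i\<in>R. prod f (R - {i}))"
  have fin: "finite R"
    by (simp add: R_def)
  have less: "i < q" if "i \<in> R" for i
    using that totatives_less q(1) by (auto simp: R_def)
  have reflect: "bij_betw (\<lambda>i. q - i) R R"
  proof (rule bij_betw_byWitness[where f' = "\<lambda>i. q - i"])
    have "coprime (q - i) q" if "i \<in> R" for i
      using that less[OF that] by (metis R_def gcd_diff2_nat coprime_iff_gcd_eq_1 in_totatives_iff)
    then show "(\<lambda>i. q - i) ` R \<subseteq> R" "(\<lambda>i. q - i) ` R \<subseteq> R"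
      using less by (auto simp: R_def in_totatives_iff)
  qed (use less in \<open>auto simp: less_imp_le\<close>)
  have XX: "X * X = (\<Prod>i\<in>R. f i + 2 * int q ^ 2)"
  proof -
    have "X = (\<Prod>i\<in>R. int q + int (q - i))"
      unfolding X_def using prod.reindex_bij_betw[OF reflect, of "\<lambda>i. int q + int i"] by simp
    then have "X * X = (\<Prod>i\<in>R. (int q + int i) * (int q + int (q - i)))"
      by (simp add: X_def prod.distrib)
    also have "\<dots> = (\<Prod>i\<in>R. f i + 2 * int q ^ 2)"
      using less by (intro prod.cong) (auto simp: f_def of_nat_diff less_imp_le algebra_simps power2_eq_square)
    finally show ?thesis .
  qed
  have YY: "Y * Y = prod f R"
  proof -
    have "Y = (\<Prod>i\<in>R. int (q - i))"
      unfolding Y_def using prod.reindex_bij_betw[OF reflect, of "\<lambda>i. int i"] by simp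
    then have "Y * Y = (\<Prod>i\<in>R. int i * int (q - i))"
      by (simp add: Y_def prod.distrib)
    also have "\<dots> = prod f R"
      using less by (intro prod.cong) (auto simp: f_def of_nat_diff less_imp_le)
    finally show ?thesis .
  qed
  have "[X * X = Y * Y + 2 * int q ^ 2 * E] (mod (2 * int q ^ 2)\<^sup>2)"
    unfolding XX YY E_def by (rule prod_add_cong_square[OF fin])
  moreover have "int q ^ 3 dvd (2 * int q ^ 2)\<^sup>2"
    by (simp add: power_mult_distrib le_imp_power_dvd dvd_mult flip: power_mult)
  ultimately have 1: "int q ^ 3 dvd X * X - (Y * Y + 2 * int q ^ 2 * E)"
    by (meson cong_iff_dvd_diff dvd_trans)
  have "int q dvd E"
    using totatives_reciprocal_sum_dvd[OF q] by (simp add: E_def R_def f_def)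
  then have "int q ^ 2 * int q dvd int q ^ 2 * (2 * E)"
    by simp
  then have "int q ^ 3 dvd 2 * int q ^ 2 * E"
    by (simp add: power3_eq_cube power2_eq_square mult.commute mult.left_commute)
  with 1 have "int q ^ 3 dvd (X * X - (Y * Y + 2 * int q ^ 2 * E)) + 2 * int q ^ 2 * E"
    by (rule dvd_add)
  then have dvd: "int q ^ 3 dvd (X + Y) * (X - Y)"
    by (simp add: algebra_simps)
  have "[X = Y] (mod int q)"
    unfolding X_def Y_def by (intro cong_prod) (simp add: cong_def)
  then have "[X + Y = Y + Y] (mod int q)"
    by (rule cong_add) simp
  moreover have "coprime (Y + Y) (int q)"
  proof -
    have "coprime Y (int q)"
      unfolding Y_def by (intro prod_coprime_left) (auto simp: R_def in_totatives_iff)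
    moreover have "coprime 2 (int q)"
      using q(2) by simp
    ultimately show ?thesis
      by (simp flip: mult_2)
  qed
  ultimately have "coprime (X + Y) (int q)"
    by (metis cong_imp_coprime cong_sym)
  then have "int q ^ 3 dvd X - Y"
    using dvd by (metis coprime_commute coprime_dvd_mult_right_iff coprime_power_left_iff)
  then show ?thesis
    by (simp add: cong_iff_dvd_diff X_def Y_def R_def)
qed

lemma central_binomial_prod:
  "((2 * q - 1) choose (q - 1)) * (\<Prod>i\<in>{0<..<q}. i) = (\<Prod>i\<in>{0<..<q}. q + i)"
proof (cases "q = 0")
  case False
  have 1: "(\<Prod>i\<in>{0<..<q}. i) = fact (q - 1)"
    using False by (simp add: fact_prod) (intro prod.cong, auto)
  have "(\<Prod>i\<in>{0<..<q}. q + i) * fact q = fact (2 * q - 1)"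
  proof -
    have "(\<Prod>i\<in>{0<..<q}. q + i) = \<Prod>{q<..<2 * q}"
      by (rule prod.reindex_bij_witness[of _ "\<lambda>i. i - q" "\<lambda>i. q + i"]) auto
    moreover have "{1..2 * q - 1} = {q<..<2 * q} \<union> {1..q}"
      using False by auto
    moreover have "\<Prod>({q<..<2 * q} \<union> {1..q}) = \<Prod>{q<..<2 * q} * \<Prod>{1..q}"
      by (rule prod.union_disjoint) auto
    ultimately show ?thesis
      by (simp add: fact_prod)
  qed
  moreover have "((2 * q - 1) choose (q - 1)) * fact (q - 1) * fact q = (fact (2 * q - 1) :: nat)"
    using binomial_fact_lemma[of "q - 1" "2 * q - 1"] False by (simp add: algebra_simps)
  ultimately show ?thesis
    unfolding 1 by (metis fact_nonzero mult_right_cancel)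
qed simp

text \<open>
  Write the binomial coefficient for \<open>q\<close> as the product of the fractions \<open>(q + i) / i\<close> over \<open>0 < i < q\<close>.
  The factors whose index is a multiple of \<open>p\<close> reproduce, after cancelling \<open>p\<close>, the product for
  \<open>r = q / p\<close>. The remaining factors are indexed by the totatives of \<open>q\<close>, and the products of their
  numerators and of their denominators agree modulo \<open>q ^ 3\<close>.
\<close>

theorem Jacobsthal_central_binomial:
  assumes p: "prime p" "p \<ge> 5" and q: "q = p * r" "r = p ^ k"
  shows "int q ^ 3 dvd int ((2 * q - 1) choose (q - 1)) - int ((2 * r - 1) choose (r - 1))"
proof -
  define R where "R = totatives q"
  define a where "a = int ((2 * q - 1) choose (q - 1))"
  define b where "b = int ((2 * r - 1) choose (r - 1))"
  \<comment> \<open>The part of the denominator contributed by the multiples of \<open>p\<close>, cancelled at the end.\<close>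
  define F where "F = int p ^ (r - 1) * int (\<Prod>i\<in>{0<..<r}. i)"
  have r: "r > 0"
    using p q by simp
  have "p \<le> q"
    using r q(1) by simp
  then have q1: "q > 1"
    using p(2) by linarith
  have split: "{0<..<q} = R \<union> (\<lambda>i. p * i) ` {0<..<r}" "R \<inter> (\<lambda>i. p * i) ` {0<..<r} = {}"
  proof -
    have notin: "q \<notin> R"
      using q1 by (simp add: R_def in_totatives_iff)
    have R: "R = {0<..q} - (\<lambda>i. p * i) ` {0<..r}"
      using totatives_prime_power_Suc[OF p(1), of k] by (simp add: R_def q)
    have "{0<..q} = insert q {0<..<q}" "(\<lambda>i. p * i) ` {0<..r} = insert q ((\<lambda>i. p * i) ` {0<..<r})"
      using q1 r q(1) p(2) by (auto simp: image_iff)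
    moreover have "(\<lambda>i. p * i) ` {0<..<r} \<subseteq> {0<..<q}"
      using q(1) p by auto
    ultimately show "{0<..<q} = R \<union> (\<lambda>i. p * i) ` {0<..<r}" "R \<inter> (\<lambda>i. p * i) ` {0<..<r} = {}"
      using notin R by auto
  qed
  have decomp: "(\<Prod>i\<in>{0<..<q}. h i) = (\<Prod>i\<in>R. h i) * (\<Prod>i\<in>{0<..<r}. h (p * i))" for h :: "nat \<Rightarrow> int"
  proof -
    have "inj_on (\<lambda>i. p * i) {0<..<r}"
      using p by (auto simp: inj_on_def)
    then show ?thesis
      unfolding split(1) using split(2) by (subst prod.union_disjoint) (auto simp: prod.reindex R_def)
  qed
  have den: "(\<Prod>i\<in>{0<..<q}. int i) = (\<Prod>i\<in>R. int i) * F"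
    unfolding decomp by (simp add: F_def prod.distrib)
  have num: "(\<Prod>i\<in>{0<..<q}. int q + int i) = (\<Prod>i\<in>R. int q + int i) * (F * b)"
  proof -
    have "(\<Prod>i\<in>{0<..<r}. int q + int (p * i)) = int p ^ (r - 1) * int (\<Prod>i\<in>{0<..<r}. r + i)"
      by (simp add: q(1) prod.distrib flip: distrib_left)
    also have "\<dots> = F * b"
      unfolding central_binomial_prod[symmetric] F_def b_def by simp
    finally show ?thesis
      unfolding decomp by simp
  qed
  have "F \<noteq> 0"
    using p by (auto simp: F_def)
  have "a * (\<Prod>i\<in>{0<..<q}. int i) = (\<Prod>i\<in>{0<..<q}. int q + int i)"
    unfolding a_def using arg_cong[OF central_binomial_prod[of q], of int] by simp
  then have "F * (a * (\<Prod>i\<in>R. int i)) = F * (b * (\<Prod>i\<in>R. int q + int i))"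
    unfolding den num by (simp add: algebra_simps)
  then have main: "a * (\<Prod>i\<in>R. int i) = b * (\<Prod>i\<in>R. int q + int i)"
    using \<open>F \<noteq> 0\<close> by simp
  have "odd q" "coprime q 3"
    using p primes_coprime[OF p(1), of 3] prime_odd_nat[OF p(1)] by (auto simp: q)
  then have "int q ^ 3 dvd b * ((\<Prod>i\<in>R. int q + int i) - (\<Prod>i\<in>R. int i))"
    using totatives_shifted_prod_cong[OF q1] by (simp add: cong_iff_dvd_diff R_def)
  then have "int q ^ 3 dvd (\<Prod>i\<in>R. int i) * (a - b)"
    using main by (simp add: algebra_simps)
  moreover have "coprime (int q ^ 3) (\<Prod>i\<in>R. int i)"
    by (intro prod_coprime_right) (auto simp: R_def in_totatives_iff coprime_commute)
  ultimately show ?thesis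
    by (simp add: coprime_dvd_mult_right_iff a_def b_def)
qed

section \<open>Prime power order\<close>

text \<open>
  For \<open>0 < j < p ^ Suc N\<close> the gcds of \<open>j\<close> with \<open>p ^ Suc N\<close> and with \<open>p ^ N\<close> coincide. The latter has
  period \<open>p ^ N\<close> in \<open>j\<close>, so \<open>p\<close> times the sum for \<open>p ^ N\<close> extends over all \<open>j < p ^ Suc N\<close> and differs from
  the sum for \<open>p ^ Suc N\<close> only in the term at \<open>j = 0\<close>.
\<close>

lemma gcd_sum_prime_power_Suc:
  fixes p :: nat and h :: "nat \<Rightarrow> nat"
  assumes p: "prime p"
  shows "(\<Sum>j<p ^ Suc N. h (gcd j (p ^ Suc N))) + h (p ^ N) =
    p * (\<Sum>j<p ^ N. h (gcd j (p ^ N))) + h (p ^ Suc N)"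
proof -
  define q where "q = p ^ N"
  have p0: "p > 0"
    using p prime_gt_0_nat by blast
  then have pos: "p * q > 0"
    by (simp add: q_def)
  have gcd_eq: "gcd j (p * q) = gcd j q" if j: "j \<in> {0<..<p * q}" for j
  proof -
    obtain i where i: "i \<le> Suc N" "gcd j (p * q) = p ^ i"
      using divides_primepow_nat[OF p, of "gcd j (p * q)" "Suc N"] by (auto simp: q_def)
    have "i \<noteq> Suc N"
    proof
      assume "i = Suc N"
      then have "p * q dvd j"
        using i by (metis gcd_dvd1 power_Suc q_def)
      then show False
        using j by (auto dest: dvd_imp_le)
    qed
    then have "gcd j (p * q) dvd q"
      using i by (simp add: q_def le_imp_power_dvd)
    then show ?thesis
      by (metis dvd_triv_right gcd.assoc gcd_nat.absorb1 gcd_nat.absorb2)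
  qed
  have range: "{..<p * q} = insert 0 {0<..<p * q}"
    using pos by auto
  have "(\<Sum>j<p * q. h (gcd j (p * q))) = h (p * q) + (\<Sum>j\<in>{0<..<p * q}. h (gcd j q))"
    unfolding range using gcd_eq by simp
  moreover have "(\<Sum>j<p * q. h (gcd j q)) = h q + (\<Sum>j\<in>{0<..<p * q}. h (gcd j q))"
    unfolding range by simp
  moreover have "(\<Sum>j<p * q. h (gcd j q)) = p * (\<Sum>j<q. h (gcd j q))"
  proof -
    have "(\<Sum>j<p * q. h (gcd j q)) = (\<Sum>m<p. \<Sum>j\<in>{m * q..<m * q + q}. h (gcd j q))"
      by (simp add: sum.nat_group)
    also have "\<dots> = (\<Sum>m<p. \<Sum>j<q. h (gcd j q))"
    proof (rule sum.cong)
      fix m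
      have "(\<Sum>j\<in>{m * q..<m * q + q}. h (gcd j q)) = (\<Sum>j<q. h (gcd (m * q + j) q))"
        by (rule sum.reindex_bij_witness[of _ "\<lambda>j. m * q + j" "\<lambda>j. j - m * q"]) auto
      also have "\<dots> = (\<Sum>j<q. h (gcd j q))"
        by (metis gcd.commute gcd_add_mult)
      finally show "(\<Sum>j\<in>{m * q..<m * q + q}. h (gcd j q)) = (\<Sum>j<q. h (gcd j q))" .
    qed simp
    finally show ?thesis
      by simp
  qed
  ultimately show ?thesis
    by (simp add: q_def)
qed

lemma num_monomials_prime_power_Suc:
  assumes p: "prime p"
  shows "int p ^ Suc N * (int (num_monomials (group_permanent (integer_mod_group (p ^ Suc N)))) -
      int (num_monomials (group_permanent (integer_mod_group (p ^ N))))) =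
    int (central_binomial (p ^ Suc N)) - int (central_binomial (p ^ N))"
proof -
  define A where "A = (\<lambda>k. num_monomials (group_permanent (integer_mod_group (p ^ k))))"
  have A: "p ^ k * A k = (\<Sum>j<p ^ k. central_binomial (gcd j (p ^ k)))" for k
    using zero_sum_multisets_count[of "p ^ k"] num_monomials_eq_zero_sum_multisets[of "p ^ k"] prime_gt_0_nat[OF p]
    by (simp add: A_def)
  have "p ^ Suc N * A (Suc N) + central_binomial (p ^ N) = p * (p ^ N * A N) + central_binomial (p ^ Suc N)"
    unfolding A by (rule gcd_sum_prime_power_Suc[OF p])
  then have "int (p ^ Suc N * A (Suc N) + central_binomial (p ^ N)) =
      int (p * (p ^ N * A N) + central_binomial (p ^ Suc N))"
    by (simp only:)
  then show ?thesis
    by (simp add: A_def algebra_simps)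
qed

theorem theorem1p7:
  fixes p N :: nat
  assumes "prime p" and "p \<ge> 5" and "N \<ge> 1"
  shows "int p dvd int ((2 * p - 1) choose (p - 1)) - 1 \<and>
    [int (num_monomials (group_permanent (integer_mod_group (p ^ N)))) - 1
      = (int ((2 * p - 1) choose (p - 1)) - 1) div int p] (mod (int p ^ 4))"
proof -
  define A where "A = (\<lambda>k. int (num_monomials (group_permanent (integer_mod_group (p ^ k)))))"
  have p0: "p > 0"
    using assms(2) by simp
  have diff: "int p ^ Suc k * (A (Suc k) - A k) =
      int (central_binomial (p ^ Suc k)) - int (central_binomial (p ^ k))" for k
    unfolding A_def by (rule num_monomials_prime_power_Suc[OF assms(1)])
  \<comment> \<open>For \<open>N = 1\<close> the claim is an equality, which also shows the divisibility.\<close>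
  have "A 0 = 1"
    using num_monomials_eq_zero_sum_multisets[of 1] zero_sum_multisets_count[of 1]
    by (simp add: A_def central_binomial_def)
  then have first: "int ((2 * p - 1) choose (p - 1)) - 1 = int p * (A 1 - 1)"
    using diff[of 0] by (simp add: central_binomial_def)
  \<comment> \<open>Dividing the cube of \<open>p ^ Suc k\<close> by \<open>p ^ Suc k\<close> leaves exponent \<open>2 * Suc k\<close>, which is at least 4
    exactly when \<open>k \<ge> 1\<close>.\<close>
  have step: "[A (Suc k) = A k] (mod int p ^ 4)" if "k \<ge> 1" for k
  proof -
    have "int (p ^ Suc k) ^ 3 dvd int (central_binomial (p ^ Suc k)) - int (central_binomial (p ^ k))"
      unfolding central_binomial_def by (rule Jacobsthal_central_binomial[OF assms(1,2) _ refl]) simp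
    also have "\<dots> = int p ^ Suc k * (A (Suc k) - A k)"
      by (rule diff[symmetric])
    also have "int (p ^ Suc k) ^ 3 = int p ^ Suc k * int p ^ (2 * Suc k)"
      by (simp add: power3_eq_cube power_mult_distrib mult_2 power_add)
    finally have "int p ^ (2 * Suc k) dvd A (Suc k) - A k"
      using p0 by (simp only: dvd_mult_cancel_left) simp
    moreover have "int p ^ 4 dvd int p ^ (2 * Suc k)"
      using that by (intro le_imp_power_dvd) simp
    ultimately show ?thesis
      by (metis cong_iff_dvd_diff dvd_trans)
  qed
  have "[A N = A 1] (mod int p ^ 4)"
    using assms(3)
  proof (induction N rule: dec_induct)
    case (step k)
    then show ?case
      using \<open>\<And>k. k \<ge> 1 \<Longrightarrow> [A (Suc k) = A k] (mod int p ^ 4)\<close> cong_trans by blast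
  qed simp
  then have "[A N - 1 = A 1 - 1] (mod int p ^ 4)"
    by (rule cong_diff) simp
  then show ?thesis
    unfolding first using p0 by (simp add: A_def)
qed

end
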